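(* Let $A(x,y)=A_0+\sum_{p=1}^dx_pA_p+\sum_{p=1}^my_pA'_p\in\mathcal{S}^k[x,y]$ and $B(x)=B_0+\sum_{p=1}^dx_pB_p\in\mathcal{S}^l[x]$ be linear pencils. If there exist positive semidefinite matrices $C=(C_{ij})_{i,j=1}^k\in\mathcal{S}^{kl}_+$ (with $l\times l$ blocks $C_{ij}$) and $C_0\in\mathcal{S}^l_+$ such that $$B_0=C_0+\sum_{i,j=1}^k(A_0)_{ij}C_{ij},\quad B_p=\sum_{i,j=1}^k(A_p)_{ij}C_{ij}\ \ (p=1,\dots,d),\quad 0=\sum_{i,j=1}^k(A'_p)_{ij}C_{ij}\ \ (p=1,\dots,m),$$ then $\pi(S_A)\subseteq S_B$.
   Context: $\mathcal{S}^k$ is the space of real symmetric $k\times k$ matrices, $\mathcal{S}^k_+$ the cone of positive semidefinite ones, and $\mathcal{S}^k[x]$ the space of symmetric $k\times k$ matrices with entries in $\mathbb{R}[x]$. A linear pencil is a matrix polynomial of degree at most one with symmetric coefficient matrices, as displayed. $\pi(S_A)=\{x\in\mathbb{R}^d\mid\exists y\in\mathbb{R}^m:\ A(x,y)\succeq0\}$ is the coordinate projection of the spectrahedron $S_A=\{(x,y)\in\mathbb{R}^{d+m}\mid A(x,y)\succeq0\}$, and $S_B=\{x\in\mathbb{R}^d\mid B(x)\succeq0\}$. *)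

theory Defs
  imports "Jordan_Normal_Form.Matrix"
begin

text \<open>
  Sizes and dimensions are natural numbers, with carriers made explicit, and all indices start
  at 0: the coefficient $A_p$ with $1 \le p \le d$ is \<open>A (p - 1)\<close>.
\<close>

definition symmetric_mats :: "nat \<Rightarrow> real mat set" where
  "symmetric_mats n = {M \<in> carrier_mat n n. M\<^sup>T = M}"

definition psd_mats :: "nat \<Rightarrow> real mat set" where
  "psd_mats n = {M \<in> symmetric_mats n. \<forall>v \<in> carrier_vec n. 0 \<le> v \<bullet> (M *\<^sub>v v)}"

text \<open>
  Matrices of a size not fixed by their type do not form a type-class monoid, so \<open>sum\<close> does not
  apply to them directly; the sum of a family of $n \times n$ matrices is taken entrywise.
\<close>

definition mat_family_sum :: "nat \<Rightarrow> ('i \<Rightarrow> real mat) \<Rightarrow> 'i set \<Rightarrow> real mat" where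
  "mat_family_sum n F I = mat n n (\<lambda>(a, b). \<Sum>i\<in>I. F i $$ (a, b))"

definition pencil :: "nat \<Rightarrow> nat \<Rightarrow> real mat \<Rightarrow> (nat \<Rightarrow> real mat) \<Rightarrow> real vec \<Rightarrow> real mat" where
  "pencil n d B0 B x = B0 + mat_family_sum n (\<lambda>p. x $ p \<cdot>\<^sub>m B p) {..<d}"

definition pencil_xy ::
  "nat \<Rightarrow> nat \<Rightarrow> nat \<Rightarrow> real mat \<Rightarrow> (nat \<Rightarrow> real mat) \<Rightarrow> (nat \<Rightarrow> real mat) \<Rightarrow> real vec \<Rightarrow> real vec \<Rightarrow> real mat"
where
  "pencil_xy n d m A0 A A' x y =
     A0 + mat_family_sum n (\<lambda>p. x $ p \<cdot>\<^sub>m A p) {..<d}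
        + mat_family_sum n (\<lambda>p. y $ p \<cdot>\<^sub>m A' p) {..<m}"

definition spectrahedron :: "nat \<Rightarrow> nat \<Rightarrow> (real vec \<Rightarrow> real mat) \<Rightarrow> real vec set" where
  "spectrahedron n d B = {x \<in> carrier_vec d. B x \<in> psd_mats n}"

text \<open>A point of $\mathbb{R}^{d+m}$ is represented by the pair of its components $(x, y)$.\<close>

definition spectrahedron_xy ::
  "nat \<Rightarrow> nat \<Rightarrow> nat \<Rightarrow> (real vec \<Rightarrow> real vec \<Rightarrow> real mat) \<Rightarrow> (real vec \<times> real vec) set" where
  "spectrahedron_xy n d m A =
     {(x, y). x \<in> carrier_vec d \<and> y \<in> carrier_vec m \<and> A x y \<in> psd_mats n}"

text \<open>The $(i, j)$ block of size $l \times l$.\<close>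

definition block :: "nat \<Rightarrow> real mat \<Rightarrow> nat \<Rightarrow> nat \<Rightarrow> real mat" where
  "block l C i j = mat l l (\<lambda>(a, b). C $$ (i * l + a, j * l + b))"

text \<open>$\sum_{i,j} M_{ij} C_{ij}$, for $M$ of size $k \times k$ and $l \times l$ blocks $C_{ij}$ of $C$.\<close>

definition block_combination :: "nat \<Rightarrow> nat \<Rightarrow> real mat \<Rightarrow> real mat \<Rightarrow> real mat" where
  "block_combination k l M C =
     mat_family_sum l (\<lambda>(i, j). M $$ (i, j) \<cdot>\<^sub>m block l C i j) ({..<k} \<times> {..<k})"

end

theory Submission
  imports Defs
begin

text \<open>
  If $A(x,y) \succeq 0$, then linearity of $M \mapsto \sum_{i,j} M_{ij} C_{ij}$ and the three
  hypotheses on \<open>C\<close> give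
  $$B(x) = C_0 + \sum_{i,j} A(x,y)_{ij} C_{ij},$$
  the condition on the coefficients $A'_p$ being exactly what makes \<open>y\<close> disappear. So it is
  enough that the block combination of a positive semidefinite \<open>M\<close> with a positive semidefinite
  \<open>C\<close> is positive semidefinite (\<open>psd_block_combination\<close>).

  For this, write \<open>M\<close> as a Gram matrix, $M = \sum_r w_r w_r^T$ (\<open>psd_form_gram\<close>). The quadratic
  form of the block combination at \<open>v\<close> is then
  $$\sum_{i,j} M_{ij}\, v^T C_{ij} v = \sum_r (w_r \otimes v)^T C\, (w_r \otimes v) \ge 0.$$
  The Gram decomposition is obtained by symmetric Gaussian elimination: one variable is
  eliminated at a time, and the Schur complement that remains is again positive semidefinite.
\<close>

section \<open>Gram decomposition of a positive semidefinite form\<close>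

text \<open>
  Matrices are functions of two indices here, because the induction on the size restricts the
  same indices to a smaller range.
\<close>

definition psd_form :: "nat \<Rightarrow> (nat \<Rightarrow> nat \<Rightarrow> real) \<Rightarrow> bool" where
  "psd_form n M \<longleftrightarrow> (\<forall>i<n. \<forall>j<n. M i j = M j i) \<and>
     (\<forall>v. 0 \<le> (\<Sum>i<n. \<Sum>j<n. M i j * v i * v j))"

lemma psd_form_Suc_quadratic:
  assumes "psd_form (Suc n) M"
  shows "0 \<le> (\<Sum>i<n. \<Sum>j<n. M i j * v i * v j) + 2 * t * (\<Sum>i<n. M i n * v i) + t\<^sup>2 * M n n"
proof -
  define u where "u = v(n := t)"
  have sym: "M n i = M i n" if "i < n" for i
    using assms that by (simp add: psd_form_def)
  have "0 \<le> (\<Sum>i<Suc n. \<Sum>j<Suc n. M i j * u i * u j)"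
    using assms unfolding psd_form_def by blast
  also have "\<dots> = (\<Sum>i<n. (\<Sum>j<n. M i j * v i * v j) + M i n * v i * t)
                 + ((\<Sum>j<n. M j n * v j * t) + M n n * t * t)"
    by (simp add: u_def sym algebra_simps)
  also have "\<dots> = (\<Sum>i<n. \<Sum>j<n. M i j * v i * v j) + 2 * t * (\<Sum>i<n. M i n * v i) + t\<^sup>2 * M n n"
    by (simp add: sum.distrib sum_distrib_left power2_eq_square algebra_simps flip: sum_distrib_right)
  finally show ?thesis .
qed

text \<open>
  A vanishing diagonal entry forces its whole column to vanish: otherwise the inequality above,
  taken at a unit vector, would be affine and not constant in \<open>t\<close>.
\<close>

lemma psd_form_diagonal:
  assumes "psd_form (Suc n) M"
  shows "0 \<le> M n n" and "M n n = 0 \<Longrightarrow> i < n \<Longrightarrow> M i n = 0"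
proof -
  show "0 \<le> M n n"
    using psd_form_Suc_quadratic[OF assms, of "\<lambda>_. 0" 1] by simp
  assume diag: "M n n = 0" and i: "i < n"
  have column: "(\<Sum>p<n. M p n * of_bool (p = i)) = M i n"
    using i by (simp add: of_bool_def if_distrib[of "\<lambda>x. _ * x"] sum.delta cong: if_cong)
  have "(\<Sum>p<n. \<Sum>q<n. M p q * of_bool (p = i) * of_bool (q = i)) = M i i"
    using i by (simp add: of_bool_def if_distrib[of "\<lambda>x. _ * x"] sum.delta cong: if_cong)
  then have affine: "0 \<le> M i i + 2 * t * M i n" for t
    using psd_form_Suc_quadratic[OF assms, of "\<lambda>p. of_bool (p = i)" t]
    by (simp add: column diag)
  show "M i n = 0"
  proof (rule ccontr)
    assume "M i n \<noteq> 0"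
    then show False
      using affine[of "- (M i i + 1) / (2 * M i n)"] by (simp add: field_simps)
  qed
qed

text \<open>
  Minimising over the last coordinate eliminates it, leaving the Schur complement. For a zero
  pivot the convention \<open>a / 0 = 0\<close> makes the same formula correct, since the column is zero too.
\<close>

lemma psd_form_schur_complement:
  assumes "psd_form (Suc n) M"
  shows "psd_form n (\<lambda>i j. M i j - M i n * M j n / M n n)"
  unfolding psd_form_def
proof (intro conjI allI impI)
  fix i j assume "i < n" "j < n"
  then have "M i j = M j i"
    using assms by (simp add: psd_form_def)
  then show "M i j - M i n * M j n / M n n = M j i - M j n * M i n / M n n"
    by simp
next
  fix v :: "nat \<Rightarrow> real"
  define s where "s = (\<Sum>i<n. M i n * v i)"
  \<comment> \<open>The minimum over \<open>t\<close> is attained at \<open>t = - s / M n n\<close>.\<close>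
  have "0 \<le> (\<Sum>i<n. \<Sum>j<n. M i j * v i * v j) + 2 * (- s / M n n) * s + (- s / M n n)\<^sup>2 * M n n"
    using psd_form_Suc_quadratic[OF assms, of v "- s / M n n"] by (simp add: s_def)
  also have "\<dots> = (\<Sum>i<n. \<Sum>j<n. M i j * v i * v j) - s * s / M n n"
    by (cases "M n n = 0") (simp_all add: field_simps power2_eq_square)
  also have "s * s / M n n = (\<Sum>i<n. \<Sum>j<n. M i n * M j n / M n n * v i * v j)"
    by (simp add: s_def sum_product sum_divide_distrib algebra_simps)
  finally show "0 \<le> (\<Sum>i<n. \<Sum>j<n. (M i j - M i n * M j n / M n n) * v i * v j)"
    by (simp add: left_diff_distrib sum_subtractf)
qed

lemma psd_form_gram:
  assumes "psd_form n M"
  shows "\<exists>w. \<forall>i<n. \<forall>j<n. M i j = (\<Sum>r<n. w r i * w r j)"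
  using assms
proof (induction n arbitrary: M)
  case 0
  show ?case by simp
next
  case (Suc n)
  obtain w where w: "M i j - M i n * M j n / M n n = (\<Sum>r<n. w r i * w r j)"
    if "i < n" "j < n" for i j
    using Suc.IH[OF psd_form_schur_complement[OF Suc.prems]] by blast
  have column: "M i n = 0" if "M n n = 0" "i < Suc n" for i
    using psd_form_diagonal(2)[OF Suc.prems that(1), of i] that by (cases "i = n") auto
  have sym: "M n i = M i n" if "i < Suc n" for i
    using Suc.prems that by (simp add: psd_form_def)
  \<comment> \<open>The last Gram vector is the pivot column, scaled; the others vanish at the pivot.\<close>
  define z where "z r i = (if r = n then M i n / sqrt (M n n) else if i = n then 0 else w r i)" for r i
  have "M i j = (\<Sum>r<Suc n. z r i * z r j)" if ij: "i < Suc n" "j < Suc n" for i j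
  proof -
    have pivot: "z n i * z n j = M i n * M j n / M n n"
      using psd_form_diagonal(1)[OF Suc.prems] by (simp add: z_def)
    show ?thesis
    proof (cases "i = n \<or> j = n")
      case True
      then have rest: "(\<Sum>r<n. z r i * z r j) = 0"
        by (auto simp: z_def intro: sum.neutral)
      have "M i n * M j n / M n n = M i j"
        using True column[of i] column[of j] sym[of i] sym[of j] ij by (cases "M n n = 0") auto
      with rest pivot show ?thesis by simp
    next
      case False
      then have "i < n" "j < n" using ij by auto
      moreover have "(\<Sum>r<n. z r i * z r j) = (\<Sum>r<n. w r i * w r j)"
        using False by (intro sum.cong) (auto simp: z_def)
      ultimately show ?thesis using w[of i j] pivot by simp
    qed
  qed
  then show ?case by blast
qed

section \<open>Quadratic forms and block combinations in coordinates\<close>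

lemma scalar_prod_mult_mat_vec:
  fixes M :: "real mat"
  assumes "M \<in> carrier_mat n n" "v \<in> carrier_vec n"
  shows "v \<bullet> (M *\<^sub>v v) = (\<Sum>i<n. \<Sum>j<n. M $$ (i, j) * v $ i * v $ j)"
  using assms
  by (auto simp: scalar_prod_def mult_mat_vec_def sum_distrib_left atLeast0LessThan
      algebra_simps intro!: sum.cong)

lemma symmetric_matsD:
  "M \<in> symmetric_mats n \<Longrightarrow> i < n \<Longrightarrow> j < n \<Longrightarrow> M $$ (i, j) = M $$ (j, i)"
  unfolding symmetric_mats_def by (metis (mono_tags, lifting) carrier_matD index_transpose_mat(1) mem_Collect_eq)

lemma symmetric_matsI:
  "M \<in> carrier_mat n n \<Longrightarrow> (\<And>i j. i < n \<Longrightarrow> j < n \<Longrightarrow> M $$ (i, j) = M $$ (j, i)) \<Longrightarrow>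
    M \<in> symmetric_mats n"
  by (auto simp: symmetric_mats_def intro!: eq_matI)

lemma psd_mats_carrier: "M \<in> psd_mats n \<Longrightarrow> M \<in> carrier_mat n n"
  by (simp add: psd_mats_def symmetric_mats_def)

lemma psd_mats_psd_form:
  assumes "M \<in> psd_mats n"
  shows "psd_form n (\<lambda>i j. M $$ (i, j))"
  unfolding psd_form_def
proof (intro conjI allI impI)
  fix i j assume "i < n" "j < n"
  then show "M $$ (i, j) = M $$ (j, i)"
    using assms by (auto simp: psd_mats_def intro: symmetric_matsD)
next
  fix v :: "nat \<Rightarrow> real"
  have "0 \<le> vec n v \<bullet> (M *\<^sub>v vec n v)"
    using assms by (simp add: psd_mats_def)
  then show "0 \<le> (\<Sum>i<n. \<Sum>j<n. M $$ (i, j) * v i * v j)"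
    by (simp add: scalar_prod_mult_mat_vec[OF psd_mats_carrier[OF assms]])
qed

lemma psd_mats_add:
  assumes "M \<in> psd_mats n" "N \<in> psd_mats n"
  shows "M + N \<in> psd_mats n"
proof -
  note carrier = psd_mats_carrier[OF assms(1)] psd_mats_carrier[OF assms(2)]
  have "M + N \<in> symmetric_mats n"
    using assms carrier
    by (intro symmetric_matsI) (auto simp: psd_mats_def symmetric_matsD[of M n] symmetric_matsD[of N n])
  moreover have "0 \<le> v \<bullet> ((M + N) *\<^sub>v v)" if v: "v \<in> carrier_vec n" for v
  proof -
    have "v \<bullet> ((M + N) *\<^sub>v v) = v \<bullet> (M *\<^sub>v v) + v \<bullet> (N *\<^sub>v v)"
      using v carrier
      by (simp add: add_mult_distrib_mat_vec[of M n n N] scalar_prod_add_distrib[of v n])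
    then show ?thesis using assms v by (simp add: psd_mats_def)
  qed
  ultimately show ?thesis by (simp add: psd_mats_def)
qed

lemma block_combination_carrier [simp]: "block_combination k l M C \<in> carrier_mat l l"
  by (simp add: block_combination_def mat_family_sum_def)

lemma block_combination_entry:
  assumes "a < l" "b < l"
  shows "block_combination k l M C $$ (a, b) =
    (\<Sum>i<k. \<Sum>j<k. M $$ (i, j) * C $$ (i * l + a, j * l + b))"
  using assms
  by (simp add: block_combination_def mat_family_sum_def block_def sum.cartesian_product split_beta)

lemma sum_lessThan_mult_blocks:
  fixes f :: "nat \<Rightarrow> real"
  shows "(\<Sum>r<k * l. f r) = (\<Sum>i<k. \<Sum>a<l. f (i * l + a))"
proof -
  have "(\<Sum>r<k * l. f r) = (\<Sum>i<k. sum f {i * l..<i * l + l})"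
    by (simp add: sum.nat_group)
  also have "\<dots> = (\<Sum>i<k. \<Sum>a<l. f (i * l + a))"
  proof (rule sum.cong[OF refl])
    fix i
    show "sum f {i * l..<i * l + l} = (\<Sum>a<l. f (i * l + a))"
      using sum.shift_bounds_nat_ivl[of f 0 "i * l" l]
      by (simp add: atLeast0LessThan add.commute)
  qed
  finally show ?thesis .
qed

section \<open>Block combinations of positive semidefinite matrices\<close>

text \<open>
  The test vector for \<open>C\<close> is the Kronecker product $w \otimes v$, whose entry at \<open>i * l + a\<close> is
  $w_i v_a$.
\<close>

lemma psd_mats_kronecker_form:
  assumes "C \<in> psd_mats (k * l)"
  shows "0 \<le> (\<Sum>i<k. \<Sum>j<k. \<Sum>a<l. \<Sum>b<l.
    w i * w j * (C $$ (i * l + a, j * l + b) * v a * v b))"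
proof -
  let ?u = "\<lambda>r. w (r div l) * v (r mod l)"
  have "0 \<le> (\<Sum>r<k * l. \<Sum>s<k * l. C $$ (r, s) * ?u r * ?u s)"
    using conjunct2[OF psd_mats_psd_form[OF assms, unfolded psd_form_def], rule_format, of ?u] .
  also have "\<dots> = (\<Sum>i<k. \<Sum>a<l. \<Sum>j<k. \<Sum>b<l.
      w i * w j * (C $$ (i * l + a, j * l + b) * v a * v b))"
    unfolding sum_lessThan_mult_blocks by (intro sum.cong refl) (simp add: algebra_simps)
  also have "\<dots> = (\<Sum>i<k. \<Sum>j<k. \<Sum>a<l. \<Sum>b<l.
      w i * w j * (C $$ (i * l + a, j * l + b) * v a * v b))"
    by (intro sum.cong refl sum.swap)
  finally show ?thesis .
qed

lemma block_combination_symmetric: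
  assumes M: "M \<in> symmetric_mats k" and C: "C \<in> symmetric_mats (k * l)"
  shows "block_combination k l M C \<in> symmetric_mats l"
proof (rule symmetric_matsI[OF block_combination_carrier])
  fix a b assume ab: "a < l" "b < l"
  have bound: "i * l + c < k * l" if "i < k" "c < l" for i c
  proof -
    have "i * l + c < Suc i * l" using that by simp
    also have "\<dots> \<le> k * l" using that by (intro mult_right_mono) auto
    finally show ?thesis .
  qed
  have "block_combination k l M C $$ (a, b) =
      (\<Sum>i<k. \<Sum>j<k. M $$ (j, i) * C $$ (j * l + b, i * l + a))"
    unfolding block_combination_entry[OF ab]
    using ab bound symmetric_matsD[OF M] symmetric_matsD[OF C]
    by (intro sum.cong refl) (metis lessThan_iff)
  also have "\<dots> = block_combination k l M C $$ (b, a)"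
    unfolding block_combination_entry[OF ab(2,1)] by (rule sum.swap)
  finally show "block_combination k l M C $$ (a, b) = block_combination k l M C $$ (b, a)" .
qed

text \<open>
  Substituting the Gram decomposition of \<open>M\<close> turns the quadratic form into a sum of values of the
  form of \<open>C\<close> at the vectors $w_r \otimes v$.
\<close>

lemma psd_block_combination:
  assumes M: "M \<in> psd_mats k" and C: "C \<in> psd_mats (k * l)"
  shows "block_combination k l M C \<in> psd_mats l"
proof -
  obtain w where w: "M $$ (i, j) = (\<Sum>r<k. w r i * w r j)" if "i < k" "j < k" for i j
    using psd_form_gram[OF psd_mats_psd_form[OF M]] by blast
  have "0 \<le> v \<bullet> (block_combination k l M C *\<^sub>v v)" if v: "v \<in> carrier_vec l" for v
  proof -
    define D where "D i j a b = C $$ (i * l + a, j * l + b) * v $ a * v $ b" for i j a b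
    have "0 \<le> (\<Sum>r<k. \<Sum>i<k. \<Sum>j<k. \<Sum>a<l. \<Sum>b<l. w r i * w r j * D i j a b)"
      unfolding D_def by (intro sum_nonneg psd_mats_kronecker_form[OF C])
    also have "\<dots> = (\<Sum>r<k. \<Sum>i<k. \<Sum>j<k. w r i * w r j * (\<Sum>a<l. \<Sum>b<l. D i j a b))"
      by (simp add: sum_distrib_left)
    also have "\<dots> = (\<Sum>i<k. \<Sum>r<k. \<Sum>j<k. w r i * w r j * (\<Sum>a<l. \<Sum>b<l. D i j a b))"
      by (rule sum.swap)
    also have "\<dots> = (\<Sum>i<k. \<Sum>j<k. \<Sum>r<k. w r i * w r j * (\<Sum>a<l. \<Sum>b<l. D i j a b))"
      by (intro sum.cong refl sum.swap)
    also have "\<dots> = (\<Sum>i<k. \<Sum>j<k. M $$ (i, j) * (\<Sum>a<l. \<Sum>b<l. D i j a b))"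
      by (intro sum.cong refl) (simp add: w sum_distrib_right)
    also have "\<dots> = (\<Sum>i<k. \<Sum>j<k. \<Sum>a<l. \<Sum>b<l. M $$ (i, j) * D i j a b)"
      by (simp add: sum_distrib_left)
    also have "\<dots> = (\<Sum>i<k. \<Sum>a<l. \<Sum>j<k. \<Sum>b<l. M $$ (i, j) * D i j a b)"
      by (intro sum.cong refl sum.swap)
    also have "\<dots> = (\<Sum>a<l. \<Sum>i<k. \<Sum>j<k. \<Sum>b<l. M $$ (i, j) * D i j a b)"
      by (rule sum.swap)
    also have "\<dots> = (\<Sum>a<l. \<Sum>i<k. \<Sum>b<l. \<Sum>j<k. M $$ (i, j) * D i j a b)"
      by (intro sum.cong refl sum.swap)
    also have "\<dots> = (\<Sum>a<l. \<Sum>b<l. \<Sum>i<k. \<Sum>j<k. M $$ (i, j) * D i j a b)"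
      by (intro sum.cong refl sum.swap)
    also have "\<dots> = v \<bullet> (block_combination k l M C *\<^sub>v v)"
      unfolding scalar_prod_mult_mat_vec[OF block_combination_carrier v]
      by (intro sum.cong refl) (simp add: block_combination_entry D_def sum_distrib_right mult.assoc)
    finally show ?thesis .
  qed
  moreover have "block_combination k l M C \<in> symmetric_mats l"
    using M C by (intro block_combination_symmetric) (auto simp: psd_mats_def)
  ultimately show ?thesis by (simp add: psd_mats_def)
qed

section \<open>Block combinations of a pencil\<close>

lemma pencil_carrier: "B0 \<in> carrier_mat n n \<Longrightarrow> pencil n d B0 B x \<in> carrier_mat n n"
  by (simp add: pencil_def mat_family_sum_def)

lemma pencil_entry:
  assumes "\<And>p. p < d \<Longrightarrow> B p \<in> carrier_mat n n" "i < n" "j < n"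
  shows "pencil n d B0 B x $$ (i, j) = B0 $$ (i, j) + (\<Sum>p<d. x $ p * B p $$ (i, j))"
proof -
  have "(x $ p \<cdot>\<^sub>m B p) $$ (i, j) = x $ p * B p $$ (i, j)" if "p < d" for p
    using assms(1)[OF that] assms(2,3) by simp
  then show ?thesis
    using assms(2,3) by (simp add: pencil_def mat_family_sum_def)
qed

lemma pencil_cong:
  assumes "\<And>p. p < d \<Longrightarrow> B p = B' p"
  shows "pencil n d B0 B x = pencil n d B0 B' x"
proof -
  have "(\<lambda>(a, b). \<Sum>p<d. (x $ p \<cdot>\<^sub>m B p) $$ (a, b)) =
      (\<lambda>(a, b). \<Sum>p<d. (x $ p \<cdot>\<^sub>m B' p) $$ (a, b))"
    using assms by (auto intro!: sum.cong)
  then show ?thesis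
    by (simp only: pencil_def mat_family_sum_def)
qed

lemma block_combination_pencil:
  assumes "\<And>p. p < d \<Longrightarrow> A p \<in> carrier_mat k k"
  shows "block_combination k l (pencil k d A0 A x) C =
    pencil l d (block_combination k l A0 C) (\<lambda>p. block_combination k l (A p) C) x"
    (is "?L = ?R")
proof (rule eq_matI)
  have R: "?R \<in> carrier_mat l l" by (simp add: pencil_carrier)
  have L: "?L \<in> carrier_mat l l" by simp
  show "dim_row ?L = dim_row ?R" "dim_col ?L = dim_col ?R"
    using carrier_matD[OF L] carrier_matD[OF R] by simp_all
  fix a b assume "a < dim_row ?R" "b < dim_col ?R"
  then have ab: "a < l" "b < l" using carrier_matD[OF R] by auto
  define c where "c i j = C $$ (i * l + a, j * l + b)" for i j
  have "?L $$ (a, b) =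
      (\<Sum>i<k. \<Sum>j<k. (A0 $$ (i, j) + (\<Sum>p<d. x $ p * A p $$ (i, j))) * c i j)"
    unfolding block_combination_entry[OF ab] c_def
    by (intro sum.cong refl) (simp add: pencil_entry assms)
  also have "\<dots> = (\<Sum>i<k. \<Sum>j<k. A0 $$ (i, j) * c i j) +
      (\<Sum>i<k. \<Sum>j<k. \<Sum>p<d. x $ p * (A p $$ (i, j) * c i j))"
    by (simp add: distrib_right sum.distrib sum_distrib_right mult.assoc)
  also have "(\<Sum>i<k. \<Sum>j<k. \<Sum>p<d. x $ p * (A p $$ (i, j) * c i j)) =
      (\<Sum>i<k. \<Sum>p<d. \<Sum>j<k. x $ p * (A p $$ (i, j) * c i j))"
    by (intro sum.cong refl sum.swap)
  also have "\<dots> = (\<Sum>p<d. \<Sum>i<k. \<Sum>j<k. x $ p * (A p $$ (i, j) * c i j))"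
    by (rule sum.swap)
  also have "(\<Sum>i<k. \<Sum>j<k. A0 $$ (i, j) * c i j) + \<dots> = ?R $$ (a, b)"
    by (simp add: pencil_entry ab block_combination_entry c_def sum_distrib_left)
  finally show "?L $$ (a, b) = ?R $$ (a, b)" .
qed

text \<open>
  Reading a pencil in \<open>(x, y)\<close> as a pencil in \<open>y\<close> whose constant term is a pencil in \<open>x\<close> lets the
  linearity of block combinations be applied once for each group of variables.
\<close>

lemma pencil_xy_eq_nested_pencil:
  "pencil_xy k d m A0 A A' x y = pencil k m (pencil k d A0 A x) A' y"
  by (simp add: pencil_xy_def pencil_def)

lemma pencil_zero_coefficients:
  assumes "B0 \<in> carrier_mat n n" "\<And>p. p < m \<Longrightarrow> B p = 0\<^sub>m n n"
  shows "pencil n m B0 B y = B0"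
  using assms by (auto simp: pencil_def mat_family_sum_def intro!: eq_matI sum.neutral)

theorem theorem5p5:
  fixes k l d m :: nat
    and A0 B0 :: "real mat"
    and A A' B :: "nat \<Rightarrow> real mat"
  assumes "A0 \<in> symmetric_mats k"
    and "\<And>p. p < d \<Longrightarrow> A p \<in> symmetric_mats k"
    and "\<And>p. p < m \<Longrightarrow> A' p \<in> symmetric_mats k"
    and "B0 \<in> symmetric_mats l"
    and "\<And>p. p < d \<Longrightarrow> B p \<in> symmetric_mats l"
    and "\<exists>C \<in> psd_mats (k * l). \<exists>C0 \<in> psd_mats l.
           B0 = C0 + block_combination k l A0 C \<and>
           (\<forall>p<d. B p = block_combination k l (A p) C) \<and>
           (\<forall>p<m. 0\<^sub>m l l = block_combination k l (A' p) C)"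
  shows "fst ` spectrahedron_xy k d m (pencil_xy k d m A0 A A')
           \<subseteq> spectrahedron l d (pencil l d B0 B)"
proof
  fix x assume "x \<in> fst ` spectrahedron_xy k d m (pencil_xy k d m A0 A A')"
  then obtain y where x: "x \<in> carrier_vec d"
    and psd: "pencil_xy k d m A0 A A' x y \<in> psd_mats k"
    by (auto simp: spectrahedron_xy_def)
  obtain C C0 where C: "C \<in> psd_mats (k * l)" and C0: "C0 \<in> psd_mats l"
    and B0: "B0 = C0 + block_combination k l A0 C"
    and B: "\<And>p. p < d \<Longrightarrow> B p = block_combination k l (A p) C"
    and A': "\<And>p. p < m \<Longrightarrow> block_combination k l (A' p) C = 0\<^sub>m l l"
    using assms(6) by metis
  have A_carrier: "\<And>p. p < d \<Longrightarrow> A p \<in> carrier_mat k k"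
    and A'_carrier: "\<And>p. p < m \<Longrightarrow> A' p \<in> carrier_mat k k"
    using assms(2,3) by (auto simp: symmetric_mats_def)
  have "block_combination k l (pencil_xy k d m A0 A A' x y) C =
      block_combination k l (pencil k d A0 A x) C"
    unfolding pencil_xy_eq_nested_pencil
    by (subst block_combination_pencil[OF A'_carrier], assumption, intro pencil_zero_coefficients) (simp_all add: A')
  also have "\<dots> = pencil l d (block_combination k l A0 C) B x"
    by (subst block_combination_pencil[OF A_carrier], assumption, intro pencil_cong)
      (simp add: B)
  finally have "pencil l d B0 B x =
      C0 + block_combination k l (pencil_xy k d m A0 A A' x y) C"
    using psd_mats_carrier[OF C0]
    by (simp add: B0 pencil_def mat_family_sum_def assoc_add_mat[of _ l l])
  also have "\<dots> \<in> psd_mats l"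
    by (rule psd_mats_add[OF C0 psd_block_combination[OF psd C]])
  finally show "x \<in> spectrahedron l d (pencil l d B0 B)"
    using x by (simp add: spectrahedron_def)
qed

end
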